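(* Let $n\geq 1$. Each subtraction Menger algebra $(G,o,-,0)$ of rank $n$ is isomorphic to some difference Menger algebra $(\Phi,\mathrm{O},\setminus,\varnothing)$ of $n$-place functions; that is, there are a set $A$, a difference Menger algebra $(\Phi,\mathrm{O},\setminus,\varnothing)$ with $\Phi\subseteq\mathcal{F}(A^n,A)$, and a bijection $P:G\to\Phi$ such that $P(x[y_1\ldots y_n])=P(x)[P(y_1)\ldots P(y_n)]$, $P(x-y)=P(x)\setminus P(y)$ and $P(0)=\varnothing$ for all $x,y,y_1,\ldots,y_n\in G$.
   Context: Partial $n$-place functions: a partial $n$-place function on a set $A$ is a partial mapping from $A^n$ into $A$, regarded as a subset of $A^{n+1}$; the set of all of them is $\mathcal{F}(A^n,A)$. The Menger superposition $\mathrm{O}:(f,g_1,\ldots,g_n)\mapsto f[g_1\ldots g_n]$ on $\mathcal{F}(A^n,A)$ is defined by: $(\bar a,c)\in f[g_1\ldots g_n]$ if and only if there is $\bar b=(b_1,\ldots,b_n)\in A^n$ with $(\bar a,b_1)\in g_1,\ldots,(\bar a,b_n)\in g_n$ and $(\bar b,c)\in f$ (for $\bar a\in A^n$, $c\in A$). A difference Menger algebra of $n$-place functions is an algebra $(\Phi,\mathrm{O},\setminus,\varnothing)$ where $\Phi\subseteq\mathcal{F}(A^n,A)$, $\varnothing\in\Phi$, $\Phi$ is closed under $\mathrm{O}$ and under the set-theoretic difference $\setminus$ of functions viewed as subsets of $A^{n+1}$. A Menger algebra of rank $n$ is a non-empty set $G$ with an $(n+1)$-ary operation $o(x,y_1,\ldots,y_n)=x[y_1\ldots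 y_n]$ satisfying $x[y_1\ldots y_n][z_1\ldots z_n]=x[y_1[z_1\ldots z_n]\ldots y_n[z_1\ldots z_n]]$. For $\bar w=(w_1,\ldots,w_n)\in G^n$ write $u[\bar w|_i\,x]=u[w_1\ldots w_{i-1}\,x\,w_{i+1}\ldots w_n]$. The set $T_n(G)$ of polynomials is the smallest set of words in a variable $x\notin G$ such that $x\in T_n(G)$, and $a[b_1\ldots b_{i-1}\,t\,b_{i+1}\ldots b_n]\in T_n(G)$ whenever $i\in\{1,\ldots,n\}$, $a,b_j\in G$ ($j\ne i$) and $t\in T_n(G)$; for $g\in G$, $t(g)\in G$ is the value of $t$ when $x$ is replaced by $g$. A subtraction algebra is an algebra $(G,-,0)$ of type $(2,0)$ satisfying $x-(y-x)=x$, $x-(x-y)=y-(y-x)$, $(x-y)-z=(x-z)-y$, $0-0=0$. A subtraction Menger algebra of rank $n$ is an algebra $(G,o,-,0)$ of type $(n+1,2,0)$ such that $(G,o)$ is a Menger algebra of rank $n$, $(G,-,0)$ is a subtraction algebra, and for all $x,y,z,u,z_1,\ldots,z_n\in G$, $\bar w\in G^n$, $i=1,\ldots,n$, $t_1,t_2\in T_n(G)$: (i) $(x-y)[z_1\ldots z_n]=x[z_1\ldots z_n]-y[z_1\ldots z_n]$; (ii) $u[\bar w|_i\,(x-(x-y))]=u[\bar w|_i\,x]-u[\bar w|_i\,(x-y)]$; (iii) if $x-y=0$, $z-t_1(x)=0$ and $z-t_2(y)=0$, then $z-t_2(x)=0$. *)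

theory Defs
  imports Main "HOL-Library.NList"
begin

text \<open>
  The set of \<open>n\<close>-tuples over \<open>X\<close> is \<open>nlists n X\<close>, the lists of length \<open>n\<close> with entries in \<open>X\<close>.
  Indices of tuples run over \<open>0, \<dots>, n - 1\<close>.
\<close>

text \<open>A partial \<open>n\<close>-place function on \<open>A\<close> is identified with its graph.\<close>

definition partial_funs :: "nat \<Rightarrow> 'b set \<Rightarrow> ('b list \<times> 'b) set set" where
  "partial_funs n A = {f. f \<subseteq> nlists n A \<times> A \<and> single_valued f}"

definition superpos ::
    "nat \<Rightarrow> 'b set \<Rightarrow> ('b list \<times> 'b) set \<Rightarrow> ('b list \<times> 'b) set list \<Rightarrow> ('b list \<times> 'b) set" where
  "superpos n A f gs =
     {(as, c). as \<in> nlists n A \<and> c \<in> A \<and>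
        (\<exists>bs \<in> nlists n A. (\<forall>i<n. (as, bs ! i) \<in> gs ! i) \<and> (bs, c) \<in> f)}"

locale difference_menger_algebra =
  fixes n :: nat and A :: "'b set" and \<Phi> :: "('b list \<times> 'b) set set"
  assumes partial_functions: "\<Phi> \<subseteq> partial_funs n A"
    and empty_closed: "{} \<in> \<Phi>"
    and superpos_closed: "\<And>f gs. f \<in> \<Phi> \<Longrightarrow> gs \<in> nlists n \<Phi> \<Longrightarrow> superpos n A f gs \<in> \<Phi>"
    and diff_closed: "\<And>f g. f \<in> \<Phi> \<Longrightarrow> g \<in> \<Phi> \<Longrightarrow> f - g \<in> \<Phi>"

locale menger_algebra =
  fixes n :: nat and G :: "'a set" and app :: "'a \<Rightarrow> 'a list \<Rightarrow> 'a"
  assumes nonempty: "G \<noteq> {}"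
    and app_closed: "\<And>x ys. x \<in> G \<Longrightarrow> ys \<in> nlists n G \<Longrightarrow> app x ys \<in> G"
    and superassoc: "\<And>x ys zs. x \<in> G \<Longrightarrow> ys \<in> nlists n G \<Longrightarrow> zs \<in> nlists n G \<Longrightarrow>
          app (app x ys) zs = app x (map (\<lambda>y. app y zs) ys)"

text \<open>
  Words in one variable: \<open>App a bs t cs\<close> stands for
  \<open>a[b\<^sub>1 \<dots> b\<^sub>i\<^sub>-\<^sub>1 t b\<^sub>i\<^sub>+\<^sub>1 \<dots> b\<^sub>n]\<close>, where \<open>bs\<close> and \<open>cs\<close> list the entries before and after \<open>t\<close>.
\<close>

datatype 'a menger_word = Var | App 'a "'a list" "'a menger_word" "'a list"

inductive_set menger_polys :: "nat \<Rightarrow> 'a set \<Rightarrow> 'a menger_word set"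
  for n :: nat and G :: "'a set" where
  Var: "Var \<in> menger_polys n G"
| App: "a \<in> G \<Longrightarrow> set bs \<subseteq> G \<Longrightarrow> set cs \<subseteq> G \<Longrightarrow> length bs + 1 + length cs = n \<Longrightarrow>
    t \<in> menger_polys n G \<Longrightarrow> App a bs t cs \<in> menger_polys n G"

primrec poly_val :: "('a \<Rightarrow> 'a list \<Rightarrow> 'a) \<Rightarrow> 'a menger_word \<Rightarrow> 'a \<Rightarrow> 'a" where
  "poly_val app Var g = g"
| "poly_val app (App a bs t cs) g = app a (bs @ poly_val app t g # cs)"

locale subtraction_algebra =
  fixes G :: "'a set" and sub :: "'a \<Rightarrow> 'a \<Rightarrow> 'a" and zero :: 'a
  assumes sub_closed: "\<And>x y. x \<in> G \<Longrightarrow> y \<in> G \<Longrightarrow> sub x y \<in> G"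
    and zero_closed: "zero \<in> G"
    and sub_absorb: "\<And>x y. x \<in> G \<Longrightarrow> y \<in> G \<Longrightarrow> sub x (sub y x) = x"
    and sub_sub_commute: "\<And>x y. x \<in> G \<Longrightarrow> y \<in> G \<Longrightarrow> sub x (sub x y) = sub y (sub y x)"
    and sub_right_commute: "\<And>x y z. x \<in> G \<Longrightarrow> y \<in> G \<Longrightarrow> z \<in> G \<Longrightarrow>
          sub (sub x y) z = sub (sub x z) y"
    and zero_sub_zero: "sub zero zero = zero"

text \<open>The tuple \<open>ws[i := v]\<close> is \<open>ws\<close> with its entry at position \<open>i\<close> replaced by \<open>v\<close>.\<close>

locale subtraction_menger_algebra =
  menger_algebra n G app + subtraction_algebra G sub zero
  for n :: nat and G :: "'a set" and app :: "'a \<Rightarrow> 'a list \<Rightarrow> 'a"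
    and sub :: "'a \<Rightarrow> 'a \<Rightarrow> 'a" and zero :: 'a +
  assumes sub_app: "\<And>x y zs. x \<in> G \<Longrightarrow> y \<in> G \<Longrightarrow> zs \<in> nlists n G \<Longrightarrow>
          app (sub x y) zs = sub (app x zs) (app y zs)"
    and app_sub_sub: "\<And>u ws i x y. u \<in> G \<Longrightarrow> ws \<in> nlists n G \<Longrightarrow> i < n \<Longrightarrow> x \<in> G \<Longrightarrow> y \<in> G \<Longrightarrow>
          app u (ws[i := sub x (sub x y)]) = sub (app u (ws[i := x])) (app u (ws[i := sub x y]))"
    and poly_sub: "\<And>x y z t\<^sub>1 t\<^sub>2. x \<in> G \<Longrightarrow> y \<in> G \<Longrightarrow> z \<in> G \<Longrightarrow>
          t\<^sub>1 \<in> menger_polys n G \<Longrightarrow> t\<^sub>2 \<in> menger_polys n G \<Longrightarrow>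
          sub x y = zero \<Longrightarrow> sub z (poly_val app t\<^sub>1 x) = zero \<Longrightarrow>
          sub z (poly_val app t\<^sub>2 y) = zero \<Longrightarrow> sub z (poly_val app t\<^sub>2 x) = zero"

text \<open>
  In HOL the base set of a representation of \<open>G :: 'a set\<close> has to live in some fixed type.
  Points are pairs \<open>(F, C)\<close> with \<open>F\<close> a subset of \<open>G\<close> and \<open>C\<close> a subset of \<open>G\<close> enlarged by
  variables numbered by \<open>nat\<close>; this is ample room for a disjoint union, indexed by filters, of
  quotients of \<open>G \<union> {e\<^sub>1, \<dots>, e\<^sub>n}\<close>.  It costs no generality: if there is any representation,
  then closing a set of at most \<open>|G|\<^sup>2\<close> witness tuples for injectivity under all represented
  functions, and restricting these to the result, gives one over a base set of cardinality
  at most \<open>|G| + \<aleph>\<^sub>0\<close>.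
\<close>

type_synonym 'a rep_point = "'a set \<times> ('a + nat) set"

end

theory Submission
  imports Defs
begin

text \<open>
  Order \<open>G\<close> by \<open>x \<le> y\<close> iff \<open>x - y = 0\<close>; then \<open>x - (x - y)\<close> is the meet of \<open>x\<close> and \<open>y\<close>.  In an
  algebra of partial functions, a point \<open>p\<close> of the graph of some member yields the set of all members
  whose graph contains \<open>p\<close>, and this set is an ultrafilter.  The representation reverses this: each
  ultrafilter \<open>F\<close> of \<open>G\<close> is read as the set of functions that send one generic tuple
  \<open>(e\<^sub>1, \<dots>, e\<^sub>n)\<close> to one chosen value.

  Relative to \<open>F\<close>, an element \<open>v\<close> is live when \<open>t(v) \<in> F\<close> for some polynomial \<open>t\<close>: then \<open>v\<close> has to be
  defined at the generic tuple, as it occurs inside a term that is defined there.  Two elements must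
  have the same value at the generic tuple when their meet is live, so the points are the classes of
  live elements under this relation, together with \<open>e\<^sub>1, \<dots>, e\<^sub>n\<close>.  The element \<open>x\<close> acts by
  \<open>(e\<^sub>1, \<dots>, e\<^sub>n) \<mapsto> [x]\<close> and \<open>([w\<^sub>1], \<dots>, [w\<^sub>n]) \<mapsto> [x[w\<^sub>1 \<dots> w\<^sub>n]]\<close>, wherever the result is live.

  The axiom \<open>poly_sub\<close> is what makes this work: if \<open>x \<le> y\<close> and \<open>x\<close> is live, then \<open>t(y) \<in> F\<close> implies
  \<open>t(x) \<in> F\<close>, for every \<open>t\<close> (\<open>live_transfer\<close>).  So one live lower bound decides all polynomials at
  once, which gives transitivity of the relation (\<open>sim_trans\<close>) and independence of representatives
  (\<open>sim_app\<close>).  The axiom \<open>app_sub_sub\<close> makes polynomials commute with relative complements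
  (\<open>poly_val_sub\<close>); combined with the ultrafilter dichotomy, this turns subtraction into set
  difference (\<open>live_sub_iff\<close>).  The disjoint union over all ultrafilters is faithful because every
  nonzero element belongs to some ultrafilter (\<open>ultrafilter_exists\<close>).
\<close>

section \<open>The order of a subtraction algebra\<close>

context subtraction_algebra
begin

notation sub (infixl "\<ominus>" 65)

definition below :: "'a \<Rightarrow> 'a \<Rightarrow> bool" (infix "\<sqsubseteq>" 50)
  where "x \<sqsubseteq> y \<longleftrightarrow> x \<ominus> y = zero"

abbreviation meet :: "'a \<Rightarrow> 'a \<Rightarrow> 'a" (infixl "\<sqinter>" 70)
  where "x \<sqinter> y \<equiv> x \<ominus> (x \<ominus> y)"

lemma sub_idem_right: "x \<in> G \<Longrightarrow> y \<in> G \<Longrightarrow> (y \<ominus> x) \<ominus> x = y \<ominus> x"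
  by (metis sub_absorb sub_closed)

text \<open>
  The elements \<open>x - x\<close> all coincide because \<open>(y - x) - (y - x) = x - x\<close>: applied to the meet of \<open>x\<close>
  and \<open>y\<close>, written in its two ways, this gives \<open>x - x\<close> and also \<open>y - y\<close>.
\<close>

lemma sub_self:
  assumes "x \<in> G"
  shows "x \<ominus> x = zero"
proof -
  have diff_diff: "(y \<ominus> x) \<ominus> (y \<ominus> x) = x \<ominus> x" if "x \<in> G" "y \<in> G" for x y
    using that by (metis sub_absorb sub_closed sub_sub_commute)
  have "x \<ominus> x = (x \<sqinter> zero) \<ominus> (x \<sqinter> zero)"
    using assms diff_diff sub_closed sub_sub_commute zero_closed by metis
  also have "\<dots> = zero \<ominus> zero"
    using assms diff_diff sub_closed zero_closed by metis
  finally show ?thesis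
    by (simp add: zero_sub_zero)
qed

lemma zero_sub: "x \<in> G \<Longrightarrow> zero \<ominus> x = zero"
  by (metis sub_idem_right sub_self)

lemma sub_zero: "x \<in> G \<Longrightarrow> x \<ominus> zero = x"
  by (metis sub_absorb zero_closed zero_sub)

lemma below_refl: "x \<in> G \<Longrightarrow> x \<sqsubseteq> x"
  by (simp add: below_def sub_self)

lemma below_zero: "x \<in> G \<Longrightarrow> x \<sqsubseteq> zero \<Longrightarrow> x = zero"
  by (simp add: below_def sub_zero)

lemma below_antisym: "x \<in> G \<Longrightarrow> y \<in> G \<Longrightarrow> x \<sqsubseteq> y \<Longrightarrow> y \<sqsubseteq> x \<Longrightarrow> x = y"
  by (metis below_def sub_sub_commute sub_zero)

lemma meet_absorb: "x \<in> G \<Longrightarrow> y \<in> G \<Longrightarrow> x \<sqsubseteq> y \<Longrightarrow> y \<sqinter> x = x"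
  by (metis below_def sub_sub_commute sub_zero)

lemma sub_below: "x \<in> G \<Longrightarrow> y \<in> G \<Longrightarrow> x \<ominus> y \<sqsubseteq> x"
  by (metis below_def sub_right_commute sub_self zero_sub)

lemma sub_mono:
  assumes "x \<in> G" "y \<in> G" "z \<in> G" "x \<sqsubseteq> y"
  shows "x \<ominus> z \<sqsubseteq> y \<ominus> z"
proof -
  have "x \<ominus> z = (y \<ominus> z) \<ominus> (y \<ominus> x)"
    using assms by (metis meet_absorb sub_closed sub_right_commute)
  then show ?thesis
    using assms by (metis sub_below sub_closed)
qed

lemma below_trans:
  assumes "x \<in> G" "y \<in> G" "z \<in> G" "x \<sqsubseteq> y" "y \<sqsubseteq> z"
  shows "x \<sqsubseteq> z"
  using assms by (metis below_def sub_closed sub_mono sub_zero)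

lemma sub_antimono:
  assumes "x \<in> G" "z \<in> G" "w \<in> G" "z \<sqsubseteq> w"
  shows "x \<ominus> w \<sqsubseteq> x \<ominus> z"
proof -
  have "(x \<ominus> w) \<ominus> (x \<ominus> z) = (x \<sqinter> z) \<ominus> w"
    using assms by (metis sub_closed sub_right_commute)
  also have "\<dots> = (z \<ominus> (z \<ominus> x)) \<ominus> w"
    using assms by (metis sub_sub_commute)
  also have "\<dots> = (z \<ominus> w) \<ominus> (z \<ominus> x)"
    using assms by (metis sub_closed sub_right_commute)
  finally show ?thesis
    using assms by (metis below_def sub_closed zero_sub)
qed

lemma meet_closed: "x \<in> G \<Longrightarrow> y \<in> G \<Longrightarrow> x \<sqinter> y \<in> G"
  by (simp add: sub_closed)

lemma meet_below_left: "x \<in> G \<Longrightarrow> y \<in> G \<Longrightarrow> x \<sqinter> y \<sqsubseteq> x"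
  by (simp add: sub_closed sub_below)

lemma meet_below_right: "x \<in> G \<Longrightarrow> y \<in> G \<Longrightarrow> x \<sqinter> y \<sqsubseteq> y"
  by (metis sub_closed sub_below sub_sub_commute)

lemma meet_greatest:
  assumes "x \<in> G" "y \<in> G" "z \<in> G" "z \<sqsubseteq> x" "z \<sqsubseteq> y"
  shows "z \<sqsubseteq> x \<sqinter> y"
proof -
  have "x \<sqinter> z \<sqsubseteq> x \<sqinter> y"
    using assms by (simp add: sub_closed sub_antimono)
  then show ?thesis
    using assms by (simp add: meet_absorb)
qed

lemma sub_meet: "x \<in> G \<Longrightarrow> y \<in> G \<Longrightarrow> x \<ominus> (x \<sqinter> y) = x \<ominus> y"
  by (simp add: meet_absorb sub_closed sub_below)

lemma meet_mono:
  assumes "x \<in> G" "y \<in> G" "x' \<in> G" "y' \<in> G" "x \<sqsubseteq> x'" "y \<sqsubseteq> y'"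
  shows "x \<sqinter> y \<sqsubseteq> x' \<sqinter> y'"
proof (rule meet_greatest)
  show "x \<sqinter> y \<sqsubseteq> x'"
    by (rule below_trans[of _ x]) (use assms in \<open>auto simp: meet_closed meet_below_left\<close>)
  show "x \<sqinter> y \<sqsubseteq> y'"
    by (rule below_trans[of _ y]) (use assms in \<open>auto simp: meet_closed meet_below_right\<close>)
qed (use assms in \<open>auto simp: meet_closed\<close>)

section \<open>Ultrafilters\<close>

definition proper_filter :: "'a set \<Rightarrow> bool" where
  "proper_filter F \<longleftrightarrow> F \<subseteq> G \<and> zero \<notin> F \<and>
     (\<forall>x\<in>F. \<forall>y\<in>G. x \<sqsubseteq> y \<longrightarrow> y \<in> F) \<and> (\<forall>x\<in>F. \<forall>y\<in>F. x \<sqinter> y \<in> F)"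

text \<open>
  There need not be a top element, so the complement of \<open>y\<close> is taken relative to each member \<open>x\<close>
  of the filter.
\<close>

definition ultrafilter :: "'a set \<Rightarrow> bool" where
  "ultrafilter F \<longleftrightarrow> proper_filter F \<and> (\<forall>x\<in>F. \<forall>y\<in>G. y \<in> F \<or> x \<ominus> y \<in> F)"

lemma proper_filterD:
  assumes "proper_filter F"
  shows "F \<subseteq> G" and "zero \<notin> F"
    and "\<And>x y. x \<in> F \<Longrightarrow> y \<in> G \<Longrightarrow> x \<sqsubseteq> y \<Longrightarrow> y \<in> F"
    and "\<And>x y. x \<in> F \<Longrightarrow> y \<in> F \<Longrightarrow> x \<sqinter> y \<in> F"
  using assms by (auto simp: proper_filter_def)

lemma sub_notin_filter:
  assumes F: "proper_filter F" and x: "x \<in> G" and y: "y \<in> F"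
  shows "x \<ominus> y \<notin> F"
proof
  assume "x \<ominus> y \<in> F"
  then have "(x \<ominus> y) \<sqinter> y \<in> F"
    using proper_filterD(4)[OF F] y by blast
  moreover have "(x \<ominus> y) \<sqinter> y = zero"
    using x y proper_filterD(1)[OF F] by (metis sub_idem_right sub_self sub_closed subsetD)
  ultimately show False
    using proper_filterD(2)[OF F] by simp
qed

text \<open>
  If \<open>x \<in> F\<close> but \<open>x - y \<notin> F\<close>, then no member of \<open>F\<close> is disjoint from \<open>y\<close>: a member disjoint from
  \<open>y\<close> could be taken below \<open>x\<close>, and would then lie below \<open>x - y\<close>.  So \<open>F\<close> and \<open>y\<close> generate a
  proper filter.
\<close>

lemma maximal_filter_is_ultrafilter:
  assumes F: "proper_filter F" and max: "\<And>H. proper_filter H \<Longrightarrow> F \<subseteq> H \<Longrightarrow> H = F"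
  shows "ultrafilter F"
  unfolding ultrafilter_def
proof (intro conjI ballI F)
  fix x y
  assume x: "x \<in> F" and y: "y \<in> G"
  note FG = subsetD[OF proper_filterD(1)[OF F]]
  define H where "H = {z \<in> G. \<exists>f\<in>F. f \<sqinter> y \<sqsubseteq> z}"
  show "y \<in> F \<or> x \<ominus> y \<in> F"
  proof (cases "zero \<in> H")
    case True
    then obtain f where f: "f \<in> F" "f \<sqinter> y = zero"
      unfolding H_def using FG y by (auto dest: below_zero[rotated] simp: meet_closed)
    define p where "p = f \<sqinter> x"
    have p: "p \<in> F" "p \<sqsubseteq> f" "p \<sqsubseteq> x"
      using f x FG proper_filterD(4)[OF F] by (auto simp: p_def meet_below_left meet_below_right)
    have "p \<sqinter> y \<sqsubseteq> f \<sqinter> y"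
      using p f y FG by (intro meet_mono) (auto simp: below_refl)
    then have "p \<sqinter> y = zero"
      using f p y FG by (simp add: below_zero meet_closed)
    then have "p \<ominus> y = p"
      using p(1) y FG by (metis sub_meet sub_zero)
    then have "p \<sqsubseteq> x \<ominus> y"
      using p x y FG sub_mono by metis
    then show ?thesis
      using p x y FG proper_filterD(3)[OF F] by (metis sub_closed)
  next
    case False
    have "proper_filter H"
      unfolding proper_filter_def
    proof (intro conjI ballI impI)
      show "H \<subseteq> G" "zero \<notin> H"
        using False by (auto simp: H_def)
    next
      fix u v
      assume "u \<in> H" "v \<in> G" "u \<sqsubseteq> v"
      then show "v \<in> H"
        unfolding H_def using FG y by (auto intro: below_trans[of _ u v] meet_closed)
    next
      fix u v
      assume "u \<in> H" "v \<in> H"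
      then obtain f g where fg: "f \<in> F" "g \<in> F" "f \<sqinter> y \<sqsubseteq> u" "g \<sqinter> y \<sqsubseteq> v"
        and uv: "u \<in> G" "v \<in> G"
        by (auto simp: H_def)
      have G: "f \<in> G" "g \<in> G" "f \<sqinter> g \<in> G" "(f \<sqinter> g) \<sqinter> y \<in> G" "f \<sqinter> y \<in> G" "g \<sqinter> y \<in> G"
        using fg FG y by (auto simp: sub_closed)
      have "(f \<sqinter> g) \<sqinter> y \<sqsubseteq> f \<sqinter> y" "(f \<sqinter> g) \<sqinter> y \<sqsubseteq> g \<sqinter> y"
        using G y by (intro meet_mono; simp add: meet_below_left meet_below_right below_refl)+
      then have "(f \<sqinter> g) \<sqinter> y \<sqsubseteq> u" "(f \<sqinter> g) \<sqinter> y \<sqsubseteq> v"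
        using below_trans G uv fg by blast+
      then have "(f \<sqinter> g) \<sqinter> y \<sqsubseteq> u \<sqinter> v"
        using G uv by (intro meet_greatest)
      then show "u \<sqinter> v \<in> H"
        using fg uv proper_filterD(4)[OF F] by (auto simp: H_def meet_closed)
    qed
    moreover have "F \<subseteq> H"
      using FG y meet_below_left unfolding H_def by blast
    moreover have "y \<in> H"
      using FG x y by (auto simp: H_def meet_below_right)
    ultimately show ?thesis
      using max by blast
  qed
qed

lemma ultrafilter_exists:
  assumes a: "a \<in> G" "a \<noteq> zero"
  obtains F where "ultrafilter F" "a \<in> F"
proof -
  let ?S = "{F. proper_filter F \<and> a \<in> F}"
  have "\<exists>M\<in>?S. \<forall>X\<in>?S. M \<subseteq> X \<longrightarrow> X = M"
  proof (rule subset_Zorn_nonempty)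
    have "proper_filter {z \<in> G. a \<sqsubseteq> z}"
      unfolding proper_filter_def
      using a by (auto simp: meet_closed meet_greatest intro: below_trans[of a] dest: below_zero)
    then show "?S \<noteq> {}"
      using a by (auto simp: below_refl)
  next
    fix C
    assume "C \<noteq> {}" and C: "subset.chain ?S C"
    have filters: "proper_filter F" "a \<in> F" if "F \<in> C" for F
      using C that by (auto simp: subset.chain_def)
    have "x \<sqinter> y \<in> \<Union>C" if xy: "x \<in> \<Union>C" "y \<in> \<Union>C" for x y
    proof -
      obtain X Y where XY: "X \<in> C" "Y \<in> C" "x \<in> X" "y \<in> Y"
        using xy by blast
      then have "X \<subseteq> Y \<or> Y \<subseteq> X"
        using C by (auto simp: subset.chain_def)
      then obtain Z where "Z \<in> C" "x \<in> Z" "y \<in> Z"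
        using XY by blast
      then show ?thesis
        using filters(1) proper_filterD(4) by blast
    qed
    then have "proper_filter (\<Union>C)"
      using proper_filterD(1-3)[OF filters(1)] unfolding proper_filter_def by blast
    then show "\<Union>C \<in> ?S"
      using filters(2) \<open>C \<noteq> {}\<close> by blast
  qed
  then obtain M where M: "proper_filter M" "a \<in> M"
    and max: "\<And>X. proper_filter X \<Longrightarrow> a \<in> X \<Longrightarrow> M \<subseteq> X \<Longrightarrow> X = M"
    by blast
  have "ultrafilter M"
    by (rule maximal_filter_is_ultrafilter[OF M(1)]) (use M(2) max in blast)
  then show ?thesis
    using M(2) that by blast
qed

end

section \<open>Polynomials of a subtraction Menger algebra\<close>

context subtraction_menger_algebra
begin

lemma poly_val_closed: "t \<in> menger_polys n G \<Longrightarrow> g \<in> G \<Longrightarrow> poly_val app t g \<in> G"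
  by (induction rule: menger_polys.induct) (auto intro!: app_closed nlistsI)

lemma poly_comp:
  assumes "t \<in> menger_polys n G" and "s \<in> menger_polys n G"
  shows "\<exists>r \<in> menger_polys n G. \<forall>g. poly_val app r g = poly_val app t (poly_val app s g)"
  using assms(1)
proof induction
  case Var
  then show ?case
    using assms(2) by auto
next
  case (App a bs cs t)
  then obtain r where "r \<in> menger_polys n G"
    "\<forall>g. poly_val app r g = poly_val app t (poly_val app s g)"
    by blast
  then show ?case
    using App.hyps by (intro bexI[of _ "App a bs r cs"]) (auto intro: menger_polys.App)
qed

text \<open>
  For \<open>y \<le> x\<close> one has \<open>x - y = x - (x - (x - y))\<close>, the meet of \<open>x\<close> with \<open>x - y\<close>, so
  \<open>app_sub_sub\<close> applies to it.
\<close>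

lemma app_sub:
  assumes "u \<in> G" "set bs \<subseteq> G" "set cs \<subseteq> G" "length bs + 1 + length cs = n"
    and "x \<in> G" "y \<in> G" "y \<sqsubseteq> x"
  shows "app u (bs @ (x \<ominus> y) # cs) = app u (bs @ x # cs) \<ominus> app u (bs @ y # cs)"
proof -
  have "bs @ x # cs \<in> nlists n G"
    using assms by (intro nlistsI) auto
  from app_sub_sub[OF assms(1) this, of "length bs" x "x \<ominus> y"] show ?thesis
    using assms meet_absorb[of y x] by (simp add: sub_closed)
qed

lemma poly_val_sub:
  assumes "t \<in> menger_polys n G" "x \<in> G" "y \<in> G" "y \<sqsubseteq> x"
  shows "poly_val app t (x \<ominus> y) = poly_val app t x \<ominus> poly_val app t y \<and>
    poly_val app t y \<sqsubseteq> poly_val app t x"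
  using assms(1)
proof induction
  case Var
  then show ?case
    using assms by simp
next
  case (App a bs cs t)
  let ?x = "poly_val app t x" and ?y = "poly_val app t y"
  have xy: "?x \<in> G" "?y \<in> G" "?y \<sqsubseteq> ?x"
    using App assms poly_val_closed by auto
  have sub: "app a (bs @ (?x \<ominus> v) # cs) = app a (bs @ ?x # cs) \<ominus> app a (bs @ v # cs)"
    if "v \<in> G" "v \<sqsubseteq> ?x" for v
    using App xy that by (intro app_sub) auto
  have G: "app a (bs @ v # cs) \<in> G" if "v \<in> G" for v
    using App that by (auto intro!: app_closed nlistsI)
  \<comment> \<open>Monotonicity holds as \<open>y = x - (x - y)\<close>, so that the value at \<open>y\<close> is a difference, too.\<close>
  have "app a (bs @ ?y # cs) = app a (bs @ ?x # cs) \<ominus> app a (bs @ (?x \<ominus> ?y) # cs)"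
    using sub[of "?x \<ominus> ?y"] xy meet_absorb[of ?y ?x] by (simp add: sub_closed sub_below)
  then have "app a (bs @ ?y # cs) \<sqsubseteq> app a (bs @ ?x # cs)"
    using G xy by (metis sub_below sub_closed)
  then show ?case
    using App.IH sub[of ?y] xy by simp
qed

section \<open>Live elements\<close>

text \<open>
  Membership in \<open>F\<close> alone would be too narrow: an argument of a superposition that is defined at the
  generic tuple has to be defined there, too, although it need not belong to \<open>F\<close>.  Liveness is
  inherited by arguments (\<open>live_entry\<close>).
\<close>

definition live :: "'a set \<Rightarrow> 'a \<Rightarrow> bool" where
  "live F v \<longleftrightarrow> (\<exists>t \<in> menger_polys n G. poly_val app t v \<in> F)"

lemma live_of_mem: "v \<in> F \<Longrightarrow> live F v"
  unfolding live_def by (rule bexI[of _ Var]) (simp_all add: menger_polys.Var)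

lemma poly_val_upward:
  assumes "ultrafilter F" "t \<in> menger_polys n G" "x \<in> G" "y \<in> G" "x \<sqsubseteq> y" "poly_val app t x \<in> F"
  shows "poly_val app t y \<in> F"
proof (rule proper_filterD(3)[OF _ assms(6)])
  show "proper_filter F"
    using assms(1) by (simp add: ultrafilter_def)
qed (use assms poly_val_sub poly_val_closed in auto)

lemma live_mono:
  assumes "ultrafilter F" "x \<in> G" "y \<in> G" "x \<sqsubseteq> y" "live F x"
  shows "live F y"
  using assms(5) poly_val_upward[OF assms(1) _ assms(2-4)] unfolding live_def by blast

text \<open>
  Apply \<open>poly_sub\<close> with the meet of \<open>s(x) \<in> F\<close> and \<open>t(y) \<in> F\<close> in the role of \<open>z\<close>, where \<open>s\<close>
  witnesses that \<open>x\<close> is live.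
\<close>

lemma live_transfer:
  assumes F: "ultrafilter F" and xy: "x \<in> G" "y \<in> G" "x \<sqsubseteq> y"
    and x: "live F x" and t: "t \<in> menger_polys n G" "poly_val app t y \<in> F"
  shows "poly_val app t x \<in> F"
proof -
  have pf: "proper_filter F"
    using F by (simp add: ultrafilter_def)
  obtain s where s: "s \<in> menger_polys n G" "poly_val app s x \<in> F"
    using x by (auto simp: live_def)
  let ?z = "poly_val app s x \<sqinter> poly_val app t y"
  have G: "poly_val app s x \<in> G" "poly_val app t y \<in> G" "poly_val app t x \<in> G"
    using poly_val_closed s t xy by auto
  have "?z \<in> F"
    using proper_filterD(4)[OF pf] s t by blast
  moreover have "?z \<sqsubseteq> poly_val app t x"
    using poly_sub[OF xy(1,2) meet_closed[OF G(1,2)] s(1) t(1)] xy(3)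
      meet_below_left[OF G(1,2)] meet_below_right[OF G(1,2)]
    by (simp add: below_def)
  ultimately show ?thesis
    using proper_filterD(3)[OF pf] G by blast
qed

lemma poly_val_split:
  assumes F: "ultrafilter F" and t: "t \<in> menger_polys n G" and xy: "x \<in> G" "y \<in> G"
    and x: "poly_val app t x \<in> F"
  shows "poly_val app t (x \<ominus> y) \<in> F \<longleftrightarrow> poly_val app t (x \<sqinter> y) \<notin> F"
proof -
  have "x \<sqinter> y \<sqsubseteq> x" "x \<sqinter> y \<in> G"
    using xy by (auto simp: meet_below_left meet_closed)
  from poly_val_sub[OF t xy(1) this(2,1)]
  have eq: "poly_val app t (x \<ominus> y) = poly_val app t x \<ominus> poly_val app t (x \<sqinter> y)"
    using xy by (simp add: sub_meet)
  have "poly_val app t x \<in> G" "poly_val app t (x \<sqinter> y) \<in> G"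
    using poly_val_closed t xy meet_closed by auto
  then show ?thesis
    using F x sub_notin_filter unfolding eq ultrafilter_def by blast
qed

lemma live_entry:
  assumes "set bs \<subseteq> G" "set cs \<subseteq> G" "length bs + 1 + length cs = n" "u \<in> G"
    and "live F (app u (bs @ v # cs))"
  shows "live F v"
proof -
  obtain t where t: "t \<in> menger_polys n G" "poly_val app t (app u (bs @ v # cs)) \<in> F"
    using assms(5) by (auto simp: live_def)
  have "App u bs Var cs \<in> menger_polys n G"
    using assms by (intro menger_polys.intros) auto
  from poly_comp[OF t(1) this] obtain r where
    "r \<in> menger_polys n G" "poly_val app r v = poly_val app t (app u (bs @ v # cs))"
    by auto
  then show ?thesis
    unfolding live_def using t(2) by metis
qed

lemma live_app_entries:
  assumes "u \<in> G" "ws \<in> nlists n G" "live F (app u ws)" "w \<in> set ws"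
  shows "live F w"
proof -
  obtain bs cs where ws: "ws = bs @ w # cs"
    using split_list[OF assms(4)] by blast
  have "set bs \<subseteq> G" "set cs \<subseteq> G" "length bs + 1 + length cs = n"
    using assms(2) unfolding ws nlists_def by simp_all
  then show ?thesis
    using live_entry assms(1,3) unfolding ws by blast
qed

section \<open>Elements with a common value\<close>

definition sim :: "'a set \<Rightarrow> 'a \<Rightarrow> 'a \<Rightarrow> bool" where
  "sim F u v \<longleftrightarrow> live F (u \<sqinter> v)"

lemma sim_refl: "v \<in> G \<Longrightarrow> live F v \<Longrightarrow> sim F v v"
  by (simp add: sim_def sub_self sub_zero)

lemma sim_sym: "u \<in> G \<Longrightarrow> v \<in> G \<Longrightarrow> sim F u v \<Longrightarrow> sim F v u"
  by (metis sim_def sub_sub_commute)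

lemma sim_live:
  assumes "ultrafilter F" "u \<in> G" "v \<in> G" "sim F u v"
  shows "live F u" and "live F v"
  using assms live_mono[of F "u \<sqinter> v"]
  by (auto simp: sim_def meet_closed meet_below_left meet_below_right)

text \<open>
  Choose \<open>t\<close> that maps the meet of \<open>y\<close> and \<open>z\<close> into \<open>F\<close>.  The meet of \<open>x\<close> and \<open>y\<close> is a live lower
  bound of \<open>y\<close>, so \<open>t\<close> maps it into \<open>F\<close> as well.  If \<open>t\<close> did not map the meet of all three
  into \<open>F\<close>, it would have to map the meet of \<open>x\<close> and \<open>y\<close>, minus \<open>z\<close>, into \<open>F\<close>; that element lies
  below \<open>y - z\<close>, and \<open>t(y - z) \<notin> F\<close>.
\<close>

lemma sim_trans:
  assumes F: "ultrafilter F" and G: "x \<in> G" "y \<in> G" "z \<in> G"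
    and xy: "sim F x y" and yz: "sim F y z"
  shows "sim F x z"
proof -
  obtain t where t: "t \<in> menger_polys n G" "poly_val app t (y \<sqinter> z) \<in> F"
    using yz by (auto simp: sim_def live_def)
  let ?m = "x \<sqinter> y"
  have m: "?m \<in> G" "?m \<sqsubseteq> y" "?m \<sqsubseteq> x"
    using G by (auto simp: meet_closed meet_below_left meet_below_right)
  have ty: "poly_val app t y \<in> F"
    by (rule poly_val_upward[OF F t(1) _ _ _ t(2)]) (use G in \<open>auto simp: meet_closed meet_below_left\<close>)
  have tm: "poly_val app t ?m \<in> F"
    using live_transfer[OF F m(1) G(2) m(2) _ t(1) ty] xy by (simp add: sim_def)
  have "poly_val app t (y \<ominus> z) \<notin> F"
    using poly_val_split[OF F t(1) G(2,3) ty] t(2) by simp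
  moreover have "?m \<ominus> z \<sqsubseteq> y \<ominus> z"
    using m G by (intro sub_mono)
  ultimately have "poly_val app t (?m \<ominus> z) \<notin> F"
    using poly_val_upward[OF F t(1)] m G by (meson sub_closed)
  then have "poly_val app t (?m \<sqinter> z) \<in> F"
    using poly_val_split[OF F t(1) m(1) G(3) tm] by simp
  then have "live F (?m \<sqinter> z)"
    using t(1) by (auto simp: live_def)
  moreover have "?m \<sqinter> z \<sqsubseteq> x \<sqinter> z"
    using m G by (intro meet_mono) (auto simp: below_refl)
  ultimately show ?thesis
    unfolding sim_def using live_mono[OF F] m G by (meson meet_closed)
qed

text \<open>
  The meet of \<open>v\<close> and \<open>v'\<close> is a live lower bound of \<open>v\<close>, so it may replace \<open>v\<close> in
  \<open>u[\<dots> v \<dots>]\<close> without loss of liveness; the result lies below both sides by monotonicity.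
\<close>

lemma sim_app_entry:
  assumes F: "ultrafilter F"
    and u: "u \<in> G" "set bs \<subseteq> G" "set cs \<subseteq> G" "length bs + 1 + length cs = n"
    and v: "v \<in> G" "v' \<in> G" "sim F v v'" and live: "live F (app u (bs @ v # cs))"
  shows "sim F (app u (bs @ v # cs)) (app u (bs @ v' # cs))"
proof -
  let ?m = "v \<sqinter> v'"
  let ?f = "\<lambda>w. app u (bs @ w # cs)"
  have m: "?m \<in> G" "?m \<sqsubseteq> v" "?m \<sqsubseteq> v'"
    using v by (auto simp: meet_closed meet_below_left meet_below_right)
  have poly: "App u bs Var cs \<in> menger_polys n G"
    using u by (intro menger_polys.intros) auto
  have closed: "?f w \<in> G" if "w \<in> G" for w
    using poly_val_closed[OF poly that] by simp
  have mono: "?f ?m \<sqsubseteq> ?f w" if "w \<in> G" "?m \<sqsubseteq> w" for w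
    using poly_val_sub[OF poly that(1) m(1) that(2)] by simp
  obtain t where t: "t \<in> menger_polys n G" "poly_val app t (?f v) \<in> F"
    using live by (auto simp: live_def)
  obtain r where r: "r \<in> menger_polys n G" "\<And>g. poly_val app r g = poly_val app t (?f g)"
    using poly_comp[OF t(1) poly] by auto
  have "poly_val app r ?m \<in> F"
    using live_transfer[OF F m(1) v(1) m(2) _ r(1)] v(3) t(2) by (simp add: sim_def r(2))
  then have "live F (?f ?m)"
    using t(1) by (auto simp: live_def r(2))
  moreover have "?f ?m \<sqsubseteq> ?f v \<sqinter> ?f v'"
    using closed mono m v by (intro meet_greatest) auto
  ultimately show ?thesis
    unfolding sim_def using live_mono[OF F] closed m v by (meson meet_closed)
qed

text \<open>Entries are replaced one at a time; \<open>bs\<close> collects those already replaced.\<close>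

lemma sim_app_suffix:
  assumes F: "ultrafilter F" and u: "u \<in> G"
    and "list_all2 (sim F) vs ws" "set vs \<subseteq> G" "set ws \<subseteq> G" "set bs \<subseteq> G"
    and "length bs + length vs = n" "live F (app u (bs @ vs))"
  shows "sim F (app u (bs @ vs)) (app u (bs @ ws))"
  using assms(3-)
proof (induction arbitrary: bs rule: list_all2_induct)
  case Nil
  then have "bs \<in> nlists n G"
    by (intro nlistsI) auto
  then show ?case
    using Nil.prems u by (simp add: sim_refl app_closed)
next
  case (Cons v vs w ws)
  have len: "length vs = length ws"
    using Cons.hyps(2) by (rule list_all2_lengthD)
  let ?p = "app u (bs @ v # vs)" and ?q = "app u (bs @ w # vs)" and ?r = "app u (bs @ w # ws)"
  have G: "?p \<in> G" "?q \<in> G" "?r \<in> G"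
    using Cons.prems u len by (auto intro!: app_closed nlistsI)
  have pq: "sim F ?p ?q"
    using Cons by (intro sim_app_entry F u) auto
  then have "live F ?q"
    using sim_live(2)[OF F] G by blast
  then have "sim F ?q ?r"
    using Cons.IH[of "bs @ [w]"] Cons.prems by simp
  then show ?case
    using sim_trans[OF F G pq] by blast
qed

lemma sim_app:
  assumes "ultrafilter F" "u \<in> G" "vs \<in> nlists n G" "ws \<in> nlists n G" "list_all2 (sim F) vs ws"
    and "live F (app u vs)"
  shows "sim F (app u vs) (app u ws)"
  using sim_app_suffix[OF assms(1,2,5), of "[]"] assms(3,4,6) by simp

text \<open>
  A polynomial \<open>t\<close> with \<open>t(a) \<in> F\<close> maps exactly one of \<open>a - b\<close> and the meet of \<open>a\<close> and \<open>b\<close>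
  into \<open>F\<close>, and by \<open>live_transfer\<close> the choice does not depend on \<open>t\<close>.  This is set difference at
  a single argument: \<open>a - b\<close> is to be defined where \<open>a\<close> is defined without sharing its value
  with \<open>b\<close>.
\<close>

lemma live_sub_iff:
  assumes F: "ultrafilter F" and G: "a \<in> G" "b \<in> G"
  shows "live F (a \<ominus> b) \<longleftrightarrow> live F a \<and> \<not> sim F a b"
proof
  assume L: "live F (a \<ominus> b)"
  have "\<not> live F (a \<sqinter> b)"
  proof
    assume "live F (a \<sqinter> b)"
    then obtain t where t: "t \<in> menger_polys n G" "poly_val app t (a \<sqinter> b) \<in> F"
      by (auto simp: live_def)
    have ta: "poly_val app t a \<in> F"
      by (rule poly_val_upward[OF F t(1) _ _ _ t(2)])
        (use G in \<open>auto simp: meet_closed meet_below_left\<close>)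
    have "poly_val app t (a \<ominus> b) \<in> F"
      by (rule live_transfer[OF F _ _ _ L t(1) ta]) (use G in \<open>auto simp: sub_closed sub_below\<close>)
    then show False
      using poly_val_split[OF F t(1) G ta] t(2) by simp
  qed
  moreover have "live F a"
    by (rule live_mono[OF F _ _ _ L]) (use G in \<open>auto simp: sub_closed sub_below\<close>)
  ultimately show "live F a \<and> \<not> sim F a b"
    by (simp add: sim_def)
next
  assume "live F a \<and> \<not> sim F a b"
  then obtain t where "t \<in> menger_polys n G" "poly_val app t a \<in> F" "poly_val app t (a \<sqinter> b) \<notin> F"
    by (auto simp: live_def sim_def)
  then show "live F (a \<ominus> b)"
    using poly_val_split[OF F _ G] by (auto simp: live_def)
qed

section \<open>The representation\<close>

definition point :: "'a set \<Rightarrow> 'a \<Rightarrow> 'a rep_point" where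
  "point F v = (F, Inl ` {u \<in> G. sim F u v})"

definition generic_point :: "'a set \<Rightarrow> nat \<Rightarrow> 'a rep_point" where
  "generic_point F i = (F, {Inr i})"

text \<open>
  The tuples on which the represented functions may be defined are described by \<open>None\<close>, for the
  generic tuple \<open>(e\<^sub>1, \<dots>, e\<^sub>n)\<close>, and by \<open>Some ws\<close>, for the tuple of classes of \<open>ws\<close>.
\<close>

definition arg_tuples :: "'a list option set" where
  "arg_tuples = insert None (Some ` nlists n G)"

primrec subst_tuple :: "'a \<Rightarrow> 'a list option \<Rightarrow> 'a" where
  "subst_tuple x None = x"
| "subst_tuple x (Some ws) = app x ws"

primrec tuple_points :: "'a set \<Rightarrow> 'a list option \<Rightarrow> 'a rep_point list" where
  "tuple_points F None = map (generic_point F) [0..<n]"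
| "tuple_points F (Some ws) = map (point F) ws"

definition rep :: "'a \<Rightarrow> ('a rep_point list \<times> 'a rep_point) set" where
  "rep x = {(tuple_points F e, point F (subst_tuple x e)) | F e.
     ultrafilter F \<and> e \<in> arg_tuples \<and> live F (subst_tuple x e)}"

definition rep_base :: "'a rep_point set" where
  "rep_base = {point F v | F v. ultrafilter F \<and> v \<in> G \<and> live F v} \<union>
     {generic_point F i | F i. ultrafilter F \<and> i < n}"

lemma point_eq_iff:
  assumes F: "ultrafilter F" and G: "u \<in> G" "v \<in> G" and u: "live F u"
  shows "point F u = point F v \<longleftrightarrow> sim F u v"
proof
  assume "point F u = point F v"
  moreover have "sim F u u"
    using G u by (simp add: sim_refl)
  ultimately show "sim F u v"
    using G by (auto simp: point_def)
next
  assume uv: "sim F u v"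
  then have "sim F w u \<longleftrightarrow> sim F w v" if "w \<in> G" for w
    using sim_trans[OF F] sim_sym G that by blast
  then show "point F u = point F v"
    by (auto simp: point_def)
qed

lemma subst_tuple_closed: "x \<in> G \<Longrightarrow> e \<in> arg_tuples \<Longrightarrow> subst_tuple x e \<in> G"
  by (auto simp: arg_tuples_def app_closed)

lemma subst_tuple_sub:
  "x \<in> G \<Longrightarrow> y \<in> G \<Longrightarrow> e \<in> arg_tuples \<Longrightarrow>
    subst_tuple (x \<ominus> y) e = subst_tuple x e \<ominus> subst_tuple y e"
  by (auto simp: arg_tuples_def sub_app)

lemma subst_tuple_app:
  "x \<in> G \<Longrightarrow> ys \<in> nlists n G \<Longrightarrow> e \<in> arg_tuples \<Longrightarrow>
    subst_tuple (app x ys) e = app x (map (\<lambda>y. subst_tuple y e) ys)"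
  by (auto simp: arg_tuples_def superassoc)

lemma length_tuple_points: "e \<in> arg_tuples \<Longrightarrow> length (tuple_points F e) = n"
  by (auto simp: arg_tuples_def)

text \<open>
  Each point records its ultrafilter.  A tuple of points determines one because it has at least one
  entry; for \<open>n = 0\<close> all the summands of the disjoint union would share the empty tuple.
\<close>

lemma tuple_points_filter:
  assumes "n \<ge> 1" "e \<in> arg_tuples" "e' \<in> arg_tuples" "tuple_points F e = tuple_points F' e'"
  shows "F = F'"
proof -
  have "fst (tuple_points F e ! 0) = F" if "e \<in> arg_tuples" for F e
    using assms(1) that
    by (cases e) (auto simp: arg_tuples_def point_def generic_point_def)
  then show ?thesis
    using assms by metis
qed

lemma sim_subst_tuple:
  assumes n: "n \<ge> 1" and F: "ultrafilter F" and x: "x \<in> G"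
    and e: "e \<in> arg_tuples" "e' \<in> arg_tuples" and eq: "tuple_points F e = tuple_points F e'"
    and live: "live F (subst_tuple x e)"
  shows "sim F (subst_tuple x e) (subst_tuple x e')"
proof -
  have ne: "generic_point F i \<noteq> point F w" for i w
    by (auto simp: point_def generic_point_def)
  have mixed: "map (generic_point F) [0..<n] \<noteq> map (point F) ws" for ws
  proof
    assume "map (generic_point F) [0..<n] = map (point F) ws"
    moreover have "generic_point F 0 \<in> set (map (generic_point F) [0..<n])"
      using n by simp
    ultimately have "generic_point F 0 \<in> set (map (point F) ws)"
      by simp
    then show False
      using ne by auto
  qed
  show ?thesis
  proof (cases e)
    case None
    then have "e' = None"
      using eq mixed by (cases e') auto
    then show ?thesis
      using None x live by (simp add: sim_refl)
  next
    case (Some vs)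
    then obtain ws where ws: "e' = Some ws"
      using eq mixed by (cases e') (auto dest: sym)
    have vs: "vs \<in> nlists n G" and ws': "ws \<in> nlists n G"
      using e Some ws by (auto simp: arg_tuples_def)
    have len: "length vs = length ws"
      using vs ws' by simp
    have "list_all2 (sim F) vs ws"
    proof (rule list_all2_all_nthI[OF len])
      fix i
      assume i: "i < length vs"
      have "live F (vs ! i)"
        by (rule live_app_entries[OF x vs]) (use live Some i in auto)
      moreover have "point F (vs ! i) = point F (ws ! i)"
        using eq Some ws i len by (metis nth_map tuple_points.simps(2))
      moreover have "vs ! i \<in> G" "ws ! i \<in> G"
        using vs ws' i by (auto intro: nlistsE_nth_in)
      ultimately show "sim F (vs ! i) (ws ! i)"
        using point_eq_iff[OF F] by blast
    qed
    then show ?thesis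
      using sim_app[OF F x vs ws'] live Some ws by simp
  qed
qed

text \<open>
  A tuple of points has many descriptions \<open>e\<close>, one for each choice of representatives; since the
  class of the result does not depend on that choice, any one of them decides membership.
\<close>

lemma mem_rep_iff:
  assumes n: "n \<ge> 1" and x: "x \<in> G" and F: "ultrafilter F" and e: "e \<in> arg_tuples"
  shows "(tuple_points F e, c) \<in> rep x \<longleftrightarrow>
    live F (subst_tuple x e) \<and> c = point F (subst_tuple x e)"
proof
  assume "(tuple_points F e, c) \<in> rep x"
  then obtain F' e' where *: "tuple_points F e = tuple_points F' e'" "c = point F' (subst_tuple x e')"
    "e' \<in> arg_tuples" "live F' (subst_tuple x e')"
    by (auto simp: rep_def)
  have [simp]: "F' = F"
    using tuple_points_filter[OF n e *(3,1)] by simp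
  have G: "subst_tuple x e' \<in> G" "subst_tuple x e \<in> G"
    using subst_tuple_closed x e * by auto
  have "sim F (subst_tuple x e') (subst_tuple x e)"
    using sim_subst_tuple[OF n F x *(3) e] * by simp
  then show "live F (subst_tuple x e) \<and> c = point F (subst_tuple x e)"
    using sim_live[OF F G] point_eq_iff[OF F G] *(2) by simp
next
  assume "live F (subst_tuple x e) \<and> c = point F (subst_tuple x e)"
  then show "(tuple_points F e, c) \<in> rep x"
    using F e by (auto simp: rep_def)
qed

lemma rep_elem:
  assumes "p \<in> rep x"
  obtains F e c where "p = (tuple_points F e, c)" "ultrafilter F" "e \<in> arg_tuples"
  using assms unfolding rep_def by blast

lemma rep_sub:
  assumes n: "n \<ge> 1" and G: "x \<in> G" "y \<in> G"
  shows "rep (x \<ominus> y) = rep x - rep y"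
proof -
  have "(tuple_points F e, c) \<in> rep (x \<ominus> y) \<longleftrightarrow> (tuple_points F e, c) \<in> rep x - rep y"
    if F: "ultrafilter F" and e: "e \<in> arg_tuples" for F e c
  proof -
    let ?a = "subst_tuple x e" and ?b = "subst_tuple y e"
    have ab: "?a \<in> G" "?b \<in> G" "?a \<ominus> ?b \<in> G"
      using subst_tuple_closed G e sub_closed by auto
    have same: "point F ?a = point F (?a \<ominus> ?b)" if "live F (?a \<ominus> ?b)"
    proof -
      have "?a \<sqinter> (?a \<ominus> ?b) = ?a \<ominus> ?b"
        using ab by (simp add: meet_absorb sub_below)
      then show ?thesis
        using that ab live_sub_iff[OF F ab(1,2)] point_eq_iff[OF F ab(1,3)] by (simp add: sim_def)
    qed
    have "\<not> sim F ?a ?b \<longleftrightarrow> \<not> (live F ?b \<and> point F ?a = point F ?b)" if "live F ?a"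
      using that point_eq_iff[OF F ab(1,2)] sim_live(2)[OF F ab(1,2)] by blast
    then show ?thesis
      using same live_sub_iff[OF F ab(1,2)]
      by (auto simp: mem_rep_iff[OF n _ F e] G sub_closed subst_tuple_sub[OF G e])
  qed
  then show ?thesis
    by (blast elim: rep_elem)
qed

lemma rep_zero: "n \<ge> 1 \<Longrightarrow> rep zero = {}"
  using rep_sub[OF _ zero_closed zero_closed] by (simp add: zero_sub_zero)

lemma tuple_points_in_base:
  assumes F: "ultrafilter F" and x: "x \<in> G" and e: "e \<in> arg_tuples"
    and live: "live F (subst_tuple x e)"
  shows "tuple_points F e \<in> nlists n rep_base"
proof (rule nlistsI)
  show "length (tuple_points F e) = n"
    using e by (rule length_tuple_points)
  show "set (tuple_points F e) \<subseteq> rep_base"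
  proof (cases e)
    case None
    then show ?thesis
      using F by (auto simp: rep_base_def)
  next
    case (Some ws)
    then have ws: "ws \<in> nlists n G"
      using e by (auto simp: arg_tuples_def)
    then have "live F w" if "w \<in> set ws" for w
      using live_app_entries[OF x ws] live Some that by simp
    then show ?thesis
      using F Some nlistsE_set[OF ws] by (auto simp: rep_base_def)
  qed
qed

lemma rep_partial_fun:
  assumes n: "n \<ge> 1" and x: "x \<in> G"
  shows "rep x \<in> partial_funs n rep_base"
proof -
  have "rep x \<subseteq> nlists n rep_base \<times> rep_base"
  proof
    fix p
    assume "p \<in> rep x"
    then obtain F e where *: "p = (tuple_points F e, point F (subst_tuple x e))" "ultrafilter F"
      "e \<in> arg_tuples" "live F (subst_tuple x e)"
      by (auto simp: rep_def)
    then show "p \<in> nlists n rep_base \<times> rep_base"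
      using tuple_points_in_base[OF *(2) x *(3,4)] subst_tuple_closed[OF x *(3)]
      by (auto simp: rep_base_def)
  qed
  moreover have "single_valued (rep x)"
  proof (rule single_valuedI)
    fix as c c'
    assume c: "(as, c) \<in> rep x" and c': "(as, c') \<in> rep x"
    obtain F e where "as = tuple_points F e" "ultrafilter F" "e \<in> arg_tuples"
      using rep_elem[OF c] by blast
    then show "c = c'"
      using c c' mem_rep_iff[OF n x] by simp
  qed
  ultimately show ?thesis
    by (simp add: partial_funs_def)
qed

lemma rep_superpos:
  assumes n: "n \<ge> 1" and x: "x \<in> G" and ys: "ys \<in> nlists n G"
  shows "rep (app x ys) = superpos n rep_base (rep x) (map rep ys)"
proof -
  have len: "length ys = n" and ysG: "set ys \<subseteq> G"
    using ys by simp_all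
  have ys_nth: "ys ! i \<in> G" if "i < n" for i
    using ys that by (rule nlistsE_nth_in)
  have xys: "app x ys \<in> G"
    using x ys by (rule app_closed)
  \<comment> \<open>The values of \<open>ys\<close> at a tuple \<open>e\<close> form again a tuple on which \<open>x\<close> may be evaluated.\<close>
  define ev where "ev e = map (\<lambda>y. subst_tuple y e) ys" for e
  have ev_closed: "ev e \<in> nlists n G" if "e \<in> arg_tuples" for e
    using len ysG subst_tuple_closed that by (intro nlistsI) (auto simp: ev_def)
  then have ev_arg: "Some (ev e) \<in> arg_tuples" if "e \<in> arg_tuples" for e
    using that by (auto simp: arg_tuples_def)
  have ev_app: "subst_tuple (app x ys) e = subst_tuple x (Some (ev e))" if "e \<in> arg_tuples" for e
    using subst_tuple_app[OF x ys that] by (simp add: ev_def)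
  show ?thesis
  proof (rule set_eqI, rule iffI)
    fix p
    assume p: "p \<in> rep (app x ys)"
    then obtain F e c where [simp]: "p = (tuple_points F e, c)"
      and F: "ultrafilter F" and e: "e \<in> arg_tuples"
      by (rule rep_elem)
    have c: "live F (subst_tuple x (Some (ev e)))" "c = point F (subst_tuple x (Some (ev e)))"
      using p mem_rep_iff[OF n xys F e] ev_app[OF e] by auto
    have "live F (subst_tuple (ys ! i) e)" if "i < n" for i
      by (rule live_app_entries[OF x ev_closed[OF e]]) (use c that len in \<open>auto simp: ev_def\<close>)
    then have "\<forall>i<n. (tuple_points F e, tuple_points F (Some (ev e)) ! i) \<in> map rep ys ! i"
      using mem_rep_iff[OF n ys_nth F e] len by (simp add: ev_def)
    moreover have "(tuple_points F (Some (ev e)), c) \<in> rep x"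
      using mem_rep_iff[OF n x F ev_arg[OF e]] c by blast
    moreover have "tuple_points F (Some (ev e)) \<in> nlists n rep_base"
      using tuple_points_in_base[OF F x ev_arg[OF e]] c by blast
    moreover have "tuple_points F e \<in> nlists n rep_base" "c \<in> rep_base"
      using p rep_partial_fun[OF n xys] by (auto simp: partial_funs_def)
    ultimately show "p \<in> superpos n rep_base (rep x) (map rep ys)"
      unfolding superpos_def by auto
  next
    fix p
    assume p: "p \<in> superpos n rep_base (rep x) (map rep ys)"
    obtain as c where [simp]: "p = (as, c)"
      by (cases p)
    obtain bs where "bs \<in> nlists n rep_base" and c: "(bs, c) \<in> rep x"
      and entries: "\<forall>i<n. (as, bs ! i) \<in> map rep ys ! i"
      using p unfolding superpos_def by auto
    then have bs: "length bs = n" and as: "\<And>i. i < n \<Longrightarrow> (as, bs ! i) \<in> rep (ys ! i)"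
      using len by auto
    obtain F e where [simp]: "as = tuple_points F e" and F: "ultrafilter F" and e: "e \<in> arg_tuples"
      using as[of 0] n unfolding rep_def by auto
    have "bs ! i = tuple_points F (Some (ev e)) ! i" if "i < n" for i
      using as[OF that] mem_rep_iff[OF n ys_nth[OF that] F e] that len by (simp add: ev_def)
    then have "bs = tuple_points F (Some (ev e))"
      using bs length_tuple_points[OF ev_arg[OF e]] by (intro nth_equalityI) auto
    then show "p \<in> rep (app x ys)"
      using c mem_rep_iff[OF n x F ev_arg[OF e]] mem_rep_iff[OF n xys F e] ev_app[OF e] by simp
  qed
qed

text \<open>
  If \<open>a \<in> F\<close>, then \<open>rep a\<close> is defined at the generic tuple of \<open>F\<close>.
\<close>

lemma rep_eq_empty_imp_zero:
  assumes a: "a \<in> G" and "rep a = {}"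
  shows "a = zero"
proof (rule ccontr)
  assume "a \<noteq> zero"
  then obtain F where "ultrafilter F" "a \<in> F"
    using ultrafilter_exists[OF a] by blast
  then have "(tuple_points F None, point F (subst_tuple a None)) \<in> rep a"
    unfolding rep_def arg_tuples_def using live_of_mem[of a F] by force
  then show False
    using assms(2) by simp
qed

lemma inj_on_rep:
  assumes n: "n \<ge> 1"
  shows "inj_on rep G"
proof (rule inj_onI)
  fix x y
  assume "x \<in> G" "y \<in> G" "rep x = rep y"
  then show "x = y"
    using rep_sub[OF n] rep_eq_empty_imp_zero
    by (intro below_antisym) (auto simp: sub_closed below_def)
qed

lemma difference_menger_algebra_rep:
  assumes n: "n \<ge> 1"
  shows "difference_menger_algebra n rep_base (rep ` G)"
proof
  show "rep ` G \<subseteq> partial_funs n rep_base"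
    using rep_partial_fun[OF n] by blast
  show "{} \<in> rep ` G"
    using rep_zero[OF n] zero_closed by blast
next
  fix f gs
  assume "f \<in> rep ` G" and gs: "gs \<in> nlists n (rep ` G)"
  then obtain x where x: "f = rep x" "x \<in> G"
    by blast
  have "gs \<in> map rep ` lists G"
    using nlistsE_set[OF gs] unfolding lists_image[symmetric] by blast
  then obtain ys where gs_ys: "gs = map rep ys" and "set ys \<subseteq> G"
    by blast
  moreover from gs have "length gs = n"
    by simp
  ultimately have ys: "ys \<in> nlists n G"
    by (intro nlistsI) simp_all
  then show "superpos n rep_base f gs \<in> rep ` G"
    unfolding x(1) gs_ys rep_superpos[OF n x(2) ys, symmetric]
    by (simp add: app_closed[OF x(2) ys])
next
  fix f g
  assume "f \<in> rep ` G" "g \<in> rep ` G"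
  then obtain x y where "x \<in> G" "y \<in> G" "f = rep x" "g = rep y"
    by blast
  then show "f - g \<in> rep ` G"
    by (simp add: rep_sub[OF n, symmetric] sub_closed)
qed

end

theorem theorem2:
  fixes n :: nat and G :: "'a set" and app :: "'a \<Rightarrow> 'a list \<Rightarrow> 'a"
    and sub :: "'a \<Rightarrow> 'a \<Rightarrow> 'a" and zero :: 'a
  assumes "n \<ge> 1"
    and "subtraction_menger_algebra n G app sub zero"
  shows "\<exists>(A :: 'a rep_point set) \<Phi> P.
           difference_menger_algebra n A \<Phi> \<and> bij_betw P G \<Phi> \<and>
           (\<forall>x\<in>G. \<forall>ys\<in>nlists n G. P (app x ys) = superpos n A (P x) (map P ys)) \<and>
           (\<forall>x\<in>G. \<forall>y\<in>G. P (sub x y) = P x - P y) \<and>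
           P zero = {}"
proof -
  interpret subtraction_menger_algebra n G app sub zero
    by (rule assms(2))
  show ?thesis
    using difference_menger_algebra_rep[OF assms(1)] inj_on_imp_bij_betw[OF inj_on_rep[OF assms(1)]]
      rep_superpos[OF assms(1)] rep_sub[OF assms(1)] rep_zero[OF assms(1)]
    by (intro exI[of _ rep_base] exI[of _ "rep ` G"] exI[of _ rep]) simp
qed

end
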